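(* Let $M>-\frac14$, $0<v<1$, and let $w>0$ be determined by $v=\frac{1}{1+w^2}$. The length of the fundamental piece of the profile curve of the Twizzler $\mathfrak{T}(M,v)$ is $$\int_0^{2\pi}\sqrt{\frac{\lambda(u)}{\mu(u)}}\,du,$$ where $$\lambda(u)=\Big(\frac{d\rho_1}{du}\Big)^2+\Big(\frac{d\rho_2}{du}\Big)^2,\qquad \mu(u)=f_1^2(\rho_1(u),\rho_2(u))+f_2^2(\rho_1(u),\rho_2(u)),$$ and the functions $\rho_1,\rho_2$ (depending on $M,w$) and $f_1,f_2$ (depending on $w$) are those given in the context.
   Context: Functions: with $$A=\frac{\sqrt{-1+Mw^2+\sqrt{1+(1+2M)w^2+M^2w^4}}}{\sqrt2\,w},\quad B=\frac{2+2M^2w^4+w^2+2(Mw^2-1)\sqrt{1+(1+2M)w^2+M^2w^4}}{w^2},$$ $$\rho_1(u)=A\cos u,\qquad \rho_2(u)=\frac{-1+\sqrt{1+4M+B\cos^2u}\,\sin u}{2\sqrt{1+w^2A^2\cos^2u}},$$ $$f_1(x_1,x_2)=\frac{-w^2x_2+2(1+w^2x_1^2)^{3/2}}{1+w^2(x_1^2+x_2^2)}x_2+1,\qquad f_2(x_1,x_2)=\frac{w^2x_2-2(1+w^2x_1^2)^{3/2}}{1+w^2(x_1^2+x_2^2)}x_1.$$ Twizzlers: a Twizzler is an immersion $\phi(s,t)=(x(s)\cos(wt)+z(s)\sin(wt),\,t,\,-x(s)\sin(wt)+z(s)\cos(wt))$ of constant mean curvature; $\alpha(s)=(x(s),z(s))$,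 $s\in\mathbb{R}$, parametrized by arc length, is its profile curve. The mean curvature (half the sum of the principal curvatures) is taken with respect to $\nu=\frac{\phi_s\times\phi_t}{|\phi_s\times\phi_t|}$. TreadmillSled: for each $s$ let $T_s$ be the unique orientation-preserving isometry of $\mathbb{R}^2$ that takes $\alpha(s)$ to $(0,0)$ and whose linear part takes $\alpha'(s)$ to $(1,0)$; the TreadmillSled of $\alpha$ is $s\mapsto T_s(0,0)$. Equivalently it is $-(\xi_1,\xi_2)$ with $\xi_1=xx'+zz'$, $\xi_2=-xz'+zx'$. $\mathfrak{T}(M,v)$, for $M>-\frac14$ and $0<v<1$, denotes the Twizzler (unique up to rigid motions) with mean curvature $1$ and parameter $w=\sqrt{(1-v)/v}$ for which the TreadmillSled of the profile curve is $-h_w^{-1}(M)$, where $h_w(x_1,x_2)=x_1^2+x_2^2+\frac{x_2}{\sqrt{1+w^2x_1^2}}$; that is, $h_w(\xi_1(s),\xi_2(s))=M$ for all $s$. The level set $h_w^{-1}(M)$ is a regular simple closed curve. A fundamental piece of the profile curve is a connected piece of the profile curve such that the TreadmillSled motion of this piece goes exactly once over the simple closed curve $-h_w^{-1}(M)$. *)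

theory Defs
  imports "HOL-Analysis.Analysis"
begin

definition surface_normal :: "(real \<times> real \<Rightarrow> real^3) \<Rightarrow> real \<times> real \<Rightarrow> real^3" where
  "surface_normal \<phi> p =
     (let n = cross3 (frechet_derivative \<phi> (at p) (1, 0)) (frechet_derivative \<phi> (at p) (0, 1))
      in n /\<^sub>R norm n)"

definition immersion :: "(real \<times> real \<Rightarrow> real^3) \<Rightarrow> bool" where
  "immersion \<phi> \<longleftrightarrow> (\<forall>p. \<phi> differentiable (at p) \<and> inj (frechet_derivative \<phi> (at p)))"

text \<open>The principal curvatures are the eigenvalues, with multiplicity, of the shape operator
  -(d nu); tangent vectors are given by their coordinates in the parameter plane, so that the
  eigenvalue equation reads d nu (v) = - kappa d phi (v).\<close>

definition principal_curvatures ::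
    "(real \<times> real \<Rightarrow> real^3) \<Rightarrow> real \<times> real \<Rightarrow> real \<Rightarrow> real \<Rightarrow> bool" where
  "principal_curvatures \<phi> p \<kappa>1 \<kappa>2 \<longleftrightarrow>
     (\<exists>N v1 v2. (surface_normal \<phi> has_derivative N) (at p) \<and>
        v1 \<noteq> v2 \<and> independent {v1, v2} \<and>
        N v1 = - (\<kappa>1 *\<^sub>R frechet_derivative \<phi> (at p) v1) \<and>
        N v2 = - (\<kappa>2 *\<^sub>R frechet_derivative \<phi> (at p) v2))"

definition has_mean_curvature :: "(real \<times> real \<Rightarrow> real^3) \<Rightarrow> real \<times> real \<Rightarrow> real \<Rightarrow> bool" where
  "has_mean_curvature \<phi> p H \<longleftrightarrow>
     (\<exists>\<kappa>1 \<kappa>2. principal_curvatures \<phi> p \<kappa>1 \<kappa>2 \<and> H = (\<kappa>1 + \<kappa>2) / 2)"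

text \<open>A plane curve \<open>\<alpha>\<close> has components \<open>\<alpha> s $ 1 = x s\<close> and \<open>\<alpha> s $ 2 = z s\<close>.\<close>

definition twizzler_map :: "real \<Rightarrow> (real \<Rightarrow> real^2) \<Rightarrow> real \<times> real \<Rightarrow> real^3" where
  "twizzler_map w \<alpha> = (\<lambda>(s, t). vector
     [\<alpha> s $ 1 * cos (w * t) + \<alpha> s $ 2 * sin (w * t),
      t,
      - (\<alpha> s $ 1) * sin (w * t) + \<alpha> s $ 2 * cos (w * t)])"

definition twice_cont_differentiable :: "(real \<Rightarrow> real^2) \<Rightarrow> bool" where
  "twice_cont_differentiable \<alpha> \<longleftrightarrow>
     \<alpha> C1_differentiable_on UNIV \<and>
     (\<lambda>s. vector_derivative \<alpha> (at s)) C1_differentiable_on UNIV"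

definition arc_length_parametrized :: "(real \<Rightarrow> real^2) \<Rightarrow> bool" where
  "arc_length_parametrized \<alpha> \<longleftrightarrow> (\<forall>s. norm (vector_derivative \<alpha> (at s)) = 1)"

text \<open>\<open>\<alpha>\<close> is the profile curve of a Twizzler with parameter \<open>w\<close> and constant mean curvature \<open>H\<close>.\<close>

definition twizzler_profile :: "real \<Rightarrow> real \<Rightarrow> (real \<Rightarrow> real^2) \<Rightarrow> bool" where
  "twizzler_profile w H \<alpha> \<longleftrightarrow>
     twice_cont_differentiable \<alpha> \<and> arc_length_parametrized \<alpha> \<and>
     immersion (twizzler_map w \<alpha>) \<and>
     (\<forall>p. has_mean_curvature (twizzler_map w \<alpha>) p H)"

definition treadmill_isometry :: "(real \<Rightarrow> real^2) \<Rightarrow> real \<Rightarrow> real^2 \<Rightarrow> real^2" where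
  "treadmill_isometry \<alpha> s =
     (THE T. \<exists>R c. rotation_matrix R \<and> T = (\<lambda>p. R *v p + c) \<and>
        T (\<alpha> s) = 0 \<and> R *v vector_derivative \<alpha> (at s) = vector [1, 0])"

definition treadmill_sled :: "(real \<Rightarrow> real^2) \<Rightarrow> real \<Rightarrow> real^2" where
  "treadmill_sled \<alpha> s = treadmill_isometry \<alpha> s 0"

definition h :: "real \<Rightarrow> real^2 \<Rightarrow> real" where
  "h w p = (p$1)^2 + (p$2)^2 + p$2 / sqrt (1 + w^2 * (p$1)^2)"

definition level_curve :: "real \<Rightarrow> real \<Rightarrow> (real^2) set" where
  "level_curve w M = {p. h w p = M}"

text \<open>\<open>\<alpha>\<close> is the profile curve of the Twizzler \<open>T(M,v)\<close>, which is determined up to rigid motions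
  only: hence a predicate. In terms of \<open>\<xi> = - treadmill_sled \<alpha>\<close>, the last conjunct says
  that \<open>h w (\<xi> s) = M\<close> for all \<open>s\<close>.\<close>

definition twizzler_MV_profile :: "real \<Rightarrow> real \<Rightarrow> (real \<Rightarrow> real^2) \<Rightarrow> bool" where
  "twizzler_MV_profile M v \<alpha> \<longleftrightarrow>
     (let w = sqrt ((1 - v) / v)
      in twizzler_profile w 1 \<alpha> \<and> (\<forall>s. - treadmill_sled \<alpha> s \<in> level_curve w M))"

text \<open>The piece of \<open>\<alpha>\<close> over \<open>[a,b]\<close> is fundamental if its TreadmillSled goes exactly once
  over the simple closed curve \<open>- level_curve w M\<close>; only the end points are identified.\<close>

definition fundamental_piece ::
    "real \<Rightarrow> real \<Rightarrow> (real \<Rightarrow> real^2) \<Rightarrow> real \<Rightarrow> real \<Rightarrow> bool" where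
  "fundamental_piece w M \<alpha> a b \<longleftrightarrow> a < b \<and>
     bij_betw (treadmill_sled \<alpha>) {a..<b} (uminus ` level_curve w M) \<and>
     treadmill_sled \<alpha> b = treadmill_sled \<alpha> a"

definition curve_length :: "(real \<Rightarrow> real^2) \<Rightarrow> real \<Rightarrow> real \<Rightarrow> real" where
  "curve_length \<alpha> a b = integral {a..b} (\<lambda>s. norm (vector_derivative \<alpha> (at s)))"

definition A :: "real \<Rightarrow> real \<Rightarrow> real" where
  "A M w = sqrt (- 1 + M * w^2 + sqrt (1 + (1 + 2*M) * w^2 + M^2 * w^4)) / (sqrt 2 * w)"

definition B :: "real \<Rightarrow> real \<Rightarrow> real" where
  "B M w = (2 + 2 * M^2 * w^4 + w^2
            + 2 * (M * w^2 - 1) * sqrt (1 + (1 + 2*M) * w^2 + M^2 * w^4)) / w^2"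

definition \<rho>1 :: "real \<Rightarrow> real \<Rightarrow> real \<Rightarrow> real" where
  "\<rho>1 M w u = A M w * cos u"

definition \<rho>2 :: "real \<Rightarrow> real \<Rightarrow> real \<Rightarrow> real" where
  "\<rho>2 M w u = (- 1 + sqrt (1 + 4*M + B M w * (cos u)^2) * sin u)
              / (2 * sqrt (1 + w^2 * (A M w)^2 * (cos u)^2))"

definition f1 :: "real \<Rightarrow> real \<Rightarrow> real \<Rightarrow> real" where
  "f1 w x1 x2 = (- (w^2) * x2 + 2 * (1 + w^2 * x1^2) powr (3/2))
                / (1 + w^2 * (x1^2 + x2^2)) * x2 + 1"

definition f2 :: "real \<Rightarrow> real \<Rightarrow> real \<Rightarrow> real" where
  "f2 w x1 x2 = (w^2 * x2 - 2 * (1 + w^2 * x1^2) powr (3/2))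
                / (1 + w^2 * (x1^2 + x2^2)) * x1"

definition lam :: "real \<Rightarrow> real \<Rightarrow> real \<Rightarrow> real" where
  "lam M w u = (deriv (\<rho>1 M w) u)^2 + (deriv (\<rho>2 M w) u)^2"

definition mu :: "real \<Rightarrow> real \<Rightarrow> real \<Rightarrow> real" where
  "mu M w u = (f1 w (\<rho>1 M w u) (\<rho>2 M w u))^2 + (f2 w (\<rho>1 M w u) (\<rho>2 M w u))^2"

end

theory Submission
  imports Defs
begin

text \<open>
Let \<open>\<xi> = - treadmill_sled \<alpha>\<close>. Since the profile curve is parametrized by arc length, the length of
a fundamental piece is the time \<open>b - a\<close> that \<open>\<xi>\<close> needs to run once around the level curve of
\<open>h\<close>. The integral is the same time, computed from a fixed parametrization of the level curve: the
curve element is \<open>sqrt \<lambda> du\<close> and the speed of \<open>\<xi>\<close> is \<open>sqrt \<mu>\<close>.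

The speed of \<open>\<xi>\<close> is where geometry enters. Expressed by \<open>\<xi>\<close>, the condition of mean curvature \<open>1\<close>
(\<open>twizzler_mean_curvature_equation\<close>) determines the curvature of the profile curve, and the
Frenet equations then become the autonomous system \<open>\<xi>' = (f\<^sub>1, f\<^sub>2)(\<xi>)\<close>
(\<open>twizzler_flow_equation\<close>). Its only rest point lies on the excluded level \<open>-1/4\<close>
(\<open>flow_field_nonzero_on_level_curve\<close>), so \<open>\<mu> > 0\<close>.

To compare the two times without a uniqueness theorem for differential equations, an angle is
transported back to the time axis. Solving \<open>h = M\<close> for the second coordinate and completing squares,
one recovers \<open>(cos u, sin u)\<close> from the point of the level curve with parameter \<open>u\<close>
(\<open>level_curve_unit_circle\<close>, \<open>level_curve_parametrization\<close>). Along \<open>\<xi>\<close> this gives a differentiable angle \<open>u(s)\<close>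
with \<open>\<xi> s = (\<rho>\<^sub>1(u(s)), \<rho>\<^sub>2(u(s)))\<close> (\<open>level_curve_angle_lift\<close>), and comparing velocities yields
\<open>\<lambda>(u(s)) u'(s)\<^sup>2 = \<mu>(u(s)) > 0\<close>. Thus \<open>u'\<close> never vanishes, and since \<open>\<xi>\<close> is injective on \<open>[a, b)\<close> and returns
at \<open>b\<close>, the angle sweeps exactly one interval of length \<open>2 \<pi>\<close> (\<open>angle_full_turn\<close>). Substituting
\<open>u = u(s)\<close> turns the integral of \<open>sqrt (\<lambda>/\<mu>)\<close> over that interval into the integral of \<open>1\<close> over \<open>[a, b]\<close>, and
periodicity moves the interval to \<open>[0, 2 \<pi>]\<close>.
\<close>

section \<open>Angles and periodic integrals\<close>

text \<open>Translating by a multiple of the period moves the left end point to some \<open>d\<close> in \<open>[0, p)\<close>;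
the part of the interval beyond \<open>p\<close> is then translated back to \<open>[0, d]\<close>.\<close>

lemma has_integral_periodic_interval:
  fixes F :: "real \<Rightarrow> real"
  assumes periodic: "\<And>x. F (x + p) = F x" and "p > 0"
    and I: "(F has_integral I) {c..c + p}"
  shows "(F has_integral I) {0..p}"
proof -
  define n where "n = \<lfloor>c / p\<rfloor>"
  define d where "d = c - of_int n * p"
  have d: "0 \<le> d" "d < p"
    using \<open>p > 0\<close> floor_divide_lower[of p c] floor_divide_upper[of p c]
    by (auto simp: d_def n_def algebra_simps)
  have periodic_nat: "F (x + of_nat m * p) = F x" for x m
  proof (induction m)
    case (Suc m)
    then show ?case using periodic[of "x + of_nat m * p"] by (simp add: algebra_simps)
  qed simp
  have periodic_int: "F (x + of_int m * p) = F x" for x m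
  proof (cases "m \<ge> 0")
    case True
    then show ?thesis using periodic_nat[of x "nat m"] by simp
  next
    case False
    then show ?thesis using periodic_nat[of "x + of_int m * p" "nat (- m)"] by simp
  qed
  have "((\<lambda>x. F (x + of_int n * p)) has_integral I) {d..d + p}"
    using has_integral_shift_real_ivl[OF I, of "of_int n * p"]
    by (simp add: d_def algebra_simps)
  then have Id: "(F has_integral I) {d..d + p}"
    by (simp add: periodic_int)
  then have int: "F integrable_on {d..d + p}" by blast
  have int1: "F integrable_on {d..p}"
    by (rule integrable_subinterval_real[OF int]) (use d in auto)
  have int2: "F integrable_on {p..d + p}"
    by (rule integrable_subinterval_real[OF int]) (use d in auto)
  define J where "J = integral {d..p} F"
  define K where "K = integral {p..d + p} F"
  have J: "(F has_integral J) {d..p}" and K: "(F has_integral K) {p..d + p}"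
    using int1 int2 by (simp_all add: J_def K_def integrable_integral)
  have "((\<lambda>x. F (x + p)) has_integral K) {0..d}"
    using has_integral_shift_real_ivl[OF K, of p] by simp
  then have "(F has_integral K) {0..d}" unfolding periodic .
  then have "(F has_integral K + J) {0..p}"
    using J d by (intro has_integral_combine[of 0 d p]) auto
  moreover have "J + K = I"
    using has_integral_combine[OF _ _ J K] has_integral_unique[OF _ Id] d by simp
  ultimately show ?thesis by (simp add: add.commute)
qed

lemma real_derivative_unique_on_Icc:
  fixes f g :: "real \<Rightarrow> real"
  assumes "a < b" "s \<in> {a..b}" and eq: "\<And>t. t \<in> {a..b} \<Longrightarrow> f t = g t"
    and "(f has_real_derivative D) (at s within {a..b})"
    and "(g has_real_derivative E) (at s within {a..b})"
  shows "D = E"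
proof -
  have "(g has_real_derivative D) (at s within {a..b})"
    using has_field_derivative_transform_within[OF assms(4) zero_less_one assms(2)] eq by simp
  with assms show ?thesis
    using vector_derivative_unique_within_closed_interval[of a b s g D E]
    by (simp add: has_real_derivative_iff_has_vector_derivative)
qed

text \<open>The angle is obtained by integrating the angular velocity \<open>c S' - S c'\<close> from an initial angle,
so it is differentiable by construction. Differentiating \<open>c\<^sup>2 + S\<^sup>2 = 1\<close> shows that \<open>(c, S)\<close> and
\<open>(cos u, sin u)\<close> rotate with the same angular velocity, so their inner product \<open>q\<close> keeps its
initial value \<open>1\<close>, which for unit vectors means that they are equal.\<close>

lemma unit_circle_lift:
  fixes c S c' S' :: "real \<Rightarrow> real"
  assumes "a < b"
    and dc: "\<And>s. s \<in> {a..b} \<Longrightarrow> (c has_real_derivative c' s) (at s within {a..b})"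
    and dS: "\<And>s. s \<in> {a..b} \<Longrightarrow> (S has_real_derivative S' s) (at s within {a..b})"
    and cont: "continuous_on {a..b} c'" "continuous_on {a..b} S'"
    and unit: "\<And>s. s \<in> {a..b} \<Longrightarrow> (c s)\<^sup>2 + (S s)\<^sup>2 = 1"
  obtains u u' where
    "\<And>s. s \<in> {a..b} \<Longrightarrow> (u has_real_derivative u' s) (at s within {a..b})"
    "continuous_on {a..b} u'"
    "\<And>s. s \<in> {a..b} \<Longrightarrow> c s = cos (u s)" "\<And>s. s \<in> {a..b} \<Longrightarrow> S s = sin (u s)"
proof -
  define u' where "u' = (\<lambda>s. c s * S' s - S s * c' s)"
  have "continuous_on {a..b} c" "continuous_on {a..b} S"
    using DERIV_continuous_on[OF dc] DERIV_continuous_on[OF dS] by auto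
  then have cont_u': "continuous_on {a..b} u'"
    unfolding u'_def using cont by (intro continuous_intros)
  then obtain g where g: "\<And>s. s \<in> {a..b} \<Longrightarrow> (g has_real_derivative u' s) (at s within {a..b})"
    using antiderivative_continuous has_real_derivative_iff_has_vector_derivative by metis
  obtain u0 where u0: "c a = cos u0" "S a = sin u0"
    using sincos_total_2pi[of "c a" "S a"] unit[of a] \<open>a < b\<close> by auto
  define u where "u = (\<lambda>s. g s - g a + u0)"
  have du: "(u has_real_derivative u' s) (at s within {a..b})" if "s \<in> {a..b}" for s
    unfolding u_def using g[OF that] by (auto intro!: derivative_eq_intros)
  define q where "q = (\<lambda>s. c s * cos (u s) + S s * sin (u s))"
  have dq: "(q has_real_derivative 0) (at s within {a..b})" if s: "s \<in> {a..b}" for s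
  proof -
    have "((\<lambda>s. (c s)\<^sup>2 + (S s)\<^sup>2) has_real_derivative 2 * (c s * c' s + S s * S' s))
            (at s within {a..b})"
      using dc[OF s] dS[OF s] by (auto intro!: derivative_eq_intros)
    from real_derivative_unique_on_Icc[OF \<open>a < b\<close> s unit this DERIV_const]
    have "2 * (c s * c' s + S s * S' s) = 0" by simp
    then have tangent: "c s * c' s + S s * S' s = 0" by simp
    have c': "c' s = - S s * u' s" and S': "S' s = c s * u' s"
      using tangent unit[OF s] unfolding u'_def by algebra+
    have "(q has_real_derivative
        c' s * cos (u s) - c s * (sin (u s) * u' s) + S' s * sin (u s) + S s * (cos (u s) * u' s))
        (at s within {a..b})"
      unfolding q_def using dc[OF s] dS[OF s] du[OF s]
      by (auto intro!: derivative_eq_intros)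
    then show ?thesis by (simp add: c' S' algebra_simps)
  qed
  have q1: "q s = 1" if s: "s \<in> {a..b}" for s
  proof -
    have "q s = q a"
      using has_field_derivative_zero_constant[OF convex_real_interval(5) dq] s \<open>a < b\<close> by force
    also have "\<dots> = (cos u0)\<^sup>2 + (sin u0)\<^sup>2" by (simp add: q_def u_def u0 power2_eq_square)
    finally show ?thesis by simp
  qed
  have "c s = cos (u s) \<and> S s = sin (u s)" if s: "s \<in> {a..b}" for s
  proof -
    have "(c s - cos (u s))\<^sup>2 + (S s - sin (u s))\<^sup>2
        = ((c s)\<^sup>2 + (S s)\<^sup>2) + ((cos (u s))\<^sup>2 + (sin (u s))\<^sup>2) - 2 * q s"
      by (simp add: q_def power2_eq_square algebra_simps)
    also have "\<dots> = 0" using unit[OF s] q1[OF s] by simp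
    finally show ?thesis by (simp add: sum_power2_eq_zero_iff)
  qed
  with du cont_u' show ?thesis using that by blast
qed

text \<open>The end angle exceeds the initial one by a positive multiple of \<open>2 \<pi>\<close>. Were it more than
\<open>2 \<pi>\<close>, the angle would pass through \<open>u a + 2 \<pi>\<close> before time \<open>b\<close>, and the point on the circle
would return too early to its initial position.\<close>

lemma increasing_angle_full_turn:
  fixes u :: "real \<Rightarrow> real"
  assumes "a < b" and cont: "continuous_on {a..b} u"
    and mono: "\<And>s t. a \<le> s \<Longrightarrow> s < t \<Longrightarrow> t \<le> b \<Longrightarrow> u s < u t"
    and inj: "inj_on (\<lambda>s. (cos (u s), sin (u s))) {a..<b}"
    and closed: "cos (u b) = cos (u a)" "sin (u b) = sin (u a)"
  shows "u ` {a..b} = {u a..u a + 2 * pi}"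
proof -
  obtain n :: int where n: "u b = u a + 2 * pi * n"
    using closed sin_cos_eq_iff by metis
  have "u a < u b" using mono \<open>a < b\<close> by auto
  then have "0 < 2 * pi * n" using n by simp
  then have "0 < n" by (simp add: zero_less_mult_iff)
  then have "2 * pi * 1 \<le> 2 * pi * of_int n" by (intro mult_left_mono) auto
  then have le: "u a + 2 * pi \<le> u b" using n by simp
  obtain s where s: "a \<le> s" "s \<le> b" "u s = u a + 2 * pi"
    using IVT'[of u a "u a + 2 * pi" b] le cont \<open>a < b\<close> by auto
  have "s = b"
  proof (rule ccontr)
    assume "s \<noteq> b"
    then have "s = a" using inj_onD[OF inj, of s a] s \<open>a < b\<close> by simp
    then show False using s(3) by simp
  qed
  then have b: "u b = u a + 2 * pi" using s by simp
  show ?thesis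
  proof
    show "u ` {a..b} \<subseteq> {u a..u a + 2 * pi}"
      using mono b by (fastforce simp: le_less)
    show "{u a..u a + 2 * pi} \<subseteq> u ` {a..b}"
      using IVT'[of u a _ b] b cont \<open>a < b\<close> by (fastforce simp: image_iff)
  qed
qed

text \<open>The derivative has constant sign because it is continuous without zeros; when it is negative,
the increasing case applies to \<open>- u\<close>.\<close>

lemma angle_full_turn:
  fixes u u' :: "real \<Rightarrow> real"
  assumes "a < b"
    and du: "\<And>s. s \<in> {a..b} \<Longrightarrow> (u has_real_derivative u' s) (at s within {a..b})"
    and cont': "continuous_on {a..b} u'" and nz: "\<And>s. s \<in> {a..b} \<Longrightarrow> u' s \<noteq> 0"
    and inj: "inj_on (\<lambda>s. (cos (u s), sin (u s))) {a..<b}"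
    and closed: "cos (u b) = cos (u a)" "sin (u b) = sin (u a)"
  obtains c where "inj_on u {a..b}" "u ` {a..b} = {c..c + 2 * pi}"
proof -
  have cont: "continuous_on {a..b} u" using du by (rule DERIV_continuous_on)
  have mono: "f s < f t"
    if df: "\<And>s. s \<in> {a..b} \<Longrightarrow> (f has_real_derivative f' s) (at s within {a..b})"
      and pos: "\<And>s. s \<in> {a..b} \<Longrightarrow> f' s > 0"
      and st: "a \<le> s" "s < t" "t \<le> b" for f f' :: "real \<Rightarrow> real" and s t
  proof (rule DERIV_pos_imp_increasing_open[OF \<open>s < t\<close>])
    fix r assume r: "s < r" "r < t"
    then have "(f has_real_derivative f' r) (at r)"
      using df[of r] st at_within_Icc_at[of a r b] by auto
    then show "\<exists>y. (f has_real_derivative y) (at r) \<and> 0 < y" using pos r st by force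
  next
    show "continuous_on {s..t} f"
      using DERIV_continuous_on[OF df] st by (auto intro: continuous_on_subset)
  qed
  have "(\<forall>s\<in>{a..b}. u' s > 0) \<or> (\<forall>s\<in>{a..b}. u' s < 0)"
  proof (rule ccontr)
    assume "\<not> ?thesis"
    then obtain s t where st: "s \<in> {a..b}" "t \<in> {a..b}" "u' s < 0" "u' t > 0"
      using nz by (metis linorder_neqE_linordered_idom)
    have "connected (u' ` {a..b})"
      using cont' by (intro connected_continuous_image) auto
    then have "0 \<in> u' ` {a..b}"
      using st connectedD_interval[of "u' ` {a..b}" "u' s" "u' t" 0] by auto
    then show False using nz by auto
  qed
  then show ?thesis
  proof
    assume pos: "\<forall>s\<in>{a..b}. u' s > 0"
    have m: "u s < u t" if "a \<le> s" "s < t" "t \<le> b" for s t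
      using mono[OF du] pos that by blast
    have "inj_on u {a..b}" by (rule linorder_inj_onI') (use m in force)
    moreover have "u ` {a..b} = {u a..u a + 2 * pi}"
      using increasing_angle_full_turn[OF \<open>a < b\<close> cont m inj closed] .
    ultimately show ?thesis by (rule that)
  next
    assume neg: "\<forall>s\<in>{a..b}. u' s < 0"
    have d: "((\<lambda>s. - u s) has_real_derivative - u' s) (at s within {a..b})" if "s \<in> {a..b}" for s
      using du[OF that] by (rule DERIV_minus)
    have m: "- u s < - u t" if "a \<le> s" "s < t" "t \<le> b" for s t
      using mono[OF d] neg that by (metis neg_0_less_iff_less)
    have "inj_on u {a..b}" by (rule linorder_inj_onI') (use m in force)
    moreover have "(\<lambda>s. - u s) ` {a..b} = {- u a..- u a + 2 * pi}"
    proof (rule increasing_angle_full_turn[OF \<open>a < b\<close> _ m])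
      show "continuous_on {a..b} (\<lambda>s. - u s)" using cont by (rule continuous_on_minus)
      show "inj_on (\<lambda>s. (cos (- u s), sin (- u s))) {a..<b}"
        using inj by (simp add: inj_on_def)
    qed (use closed in auto)
    then have "uminus ` (\<lambda>s. - u s) ` {a..b} = uminus ` {- u a..- u a + 2 * pi}" by simp
    then have "u ` {a..b} = {u a - 2 * pi..u a - 2 * pi + 2 * pi}"
      by (simp add: image_image)
    ultimately show ?thesis by (rule that)
  qed
qed

section \<open>The mean curvature of a Twizzler\<close>

text \<open>If \<open>I\<close> and \<open>II\<close> are the symmetric matrices of the first and second fundamental forms, the
hypotheses say \<open>II v\<^sub>i = k\<^sub>i I v\<^sub>i\<close> for two independent vectors. Hence \<open>k\<^sub>1 + k\<^sub>2\<close> is the trace of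
\<open>I\<^sup>-\<^sup>1 II\<close>, and the conclusion is the classical formula for the mean curvature.\<close>

lemma trace_of_generalized_eigenvalues:
  fixes E F G e f g k1 k2 p1 q1 p2 q2 :: real
  assumes "k1 * (E * p1 + F * q1) = e * p1 + f * q1" "k1 * (F * p1 + G * q1) = f * p1 + g * q1"
    and "k2 * (E * p2 + F * q2) = e * p2 + f * q2" "k2 * (F * p2 + G * q2) = f * p2 + g * q2"
    and "p1 * q2 - p2 * q1 \<noteq> 0"
  shows "(k1 + k2) * (E * G - F\<^sup>2) = e * G - 2 * f * F + g * E"
proof -
  have "(p1 * q2 - p2 * q1) * ((k1 + k2) * (E * G - F\<^sup>2))
      = (p1 * q2 - p2 * q1) * (e * G - 2 * f * F + g * E)"
    using assms(1-4) by algebra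
  then show ?thesis using assms(5) by simp
qed

lemma independent_pair_det_nonzero:
  fixes v1 v2 :: "real \<times> real"
  assumes "v1 \<noteq> v2" "independent {v1, v2}"
  shows "fst v1 * snd v2 - fst v2 * snd v1 \<noteq> 0"
proof
  assume det: "fst v1 * snd v2 - fst v2 * snd v1 = 0"
  have coeff: "c1 = 0 \<and> c2 = 0" if "c1 *\<^sub>R v1 + c2 *\<^sub>R v2 = 0" for c1 c2
  proof -
    let ?u = "\<lambda>v. if v = v1 then c1 else c2"
    have "(\<Sum>v\<in>{v1, v2}. ?u v *\<^sub>R v) = 0" using that \<open>v1 \<noteq> v2\<close> by simp
    then have "?u v1 = 0" "?u v2 = 0"
      using independentD[OF assms(2), of "{v1, v2}" ?u] by blast+
    then show ?thesis using \<open>v1 \<noteq> v2\<close> by (simp split: if_splits)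
  qed
  have "snd v2 *\<^sub>R v1 + (- snd v1) *\<^sub>R v2 = 0" "fst v2 *\<^sub>R v1 + (- fst v1) *\<^sub>R v2 = 0"
    using det by (simp_all add: prod_eq_iff algebra_simps)
  from coeff[OF this(1)] coeff[OF this(2)] have "v1 = 0" "v2 = 0" by (simp_all add: prod_eq_iff)
  then show False using \<open>v1 \<noteq> v2\<close> by simp
qed

lemma has_derivative_vector_3:
  fixes f g h :: "'a::real_normed_vector \<Rightarrow> real"
  assumes "(f has_derivative f') F" "(g has_derivative g') F" "(h has_derivative h') F"
  shows "((\<lambda>p. vector [f p, g p, h p] :: real^3) has_derivative
           (\<lambda>v. vector [f' v, g' v, h' v])) F"
proof -
  have eq: "(vector [a, b, c] :: real^3) = a *\<^sub>R axis 1 1 + b *\<^sub>R axis 2 1 + c *\<^sub>R axis 3 1"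
    for a b c :: real
    by (simp add: vec_eq_iff forall_3 axis_def)
  show ?thesis unfolding eq using assms by (auto intro!: derivative_eq_intros)
qed

text \<open>The second fundamental form of a Twizzler. All points \<open>(s, t)\<close> with the same \<open>s\<close> are congruent
under a screw motion, so the points with \<open>t = 0\<close> carry all the information. The derivative of
the normal enters only through its inner products with the coordinate tangents, and these come
from differentiating \<open>\<nu> \<bullet> \<phi>\<^sub>s = 0\<close> and \<open>\<nu> \<bullet> \<phi>\<^sub>t = 0\<close>; the normal itself is never differentiated
explicitly. With \<open>\<xi>\<close> as in the overview, the factor \<open>x' z2 - z' x2\<close> is the curvature of the
profile curve and \<open>1 + w\<^sup>2 \<xi>1\<^sup>2\<close> is the determinant of the first fundamental form.\<close>

lemma twizzler_mean_curvature_equation: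
  fixes \<alpha> :: "real \<Rightarrow> real^2" and x z x' z' :: "real \<Rightarrow> real" and w s H x2 z2 :: real
  assumes \<alpha>: "\<And>r. x r = \<alpha> r $ 1" "\<And>r. z r = \<alpha> r $ 2"
    and d: "\<And>r. (x has_real_derivative x' r) (at r)" "\<And>r. (z has_real_derivative z' r) (at r)"
    and d2: "(x' has_real_derivative x2) (at s)" "(z' has_real_derivative z2) (at s)"
    and unit: "\<And>r. (x' r)\<^sup>2 + (z' r)\<^sup>2 = 1"
    and H: "has_mean_curvature (twizzler_map w \<alpha>) (s, 0) H"
  shows "(x' s * z2 - z' s * x2) * (1 + w\<^sup>2 * ((x s)\<^sup>2 + (z s)\<^sup>2))
           + w\<^sup>2 * (x' s * z s - x s * z' s)
       = 2 * H * sqrt (1 + w\<^sup>2 * (x s * x' s + z s * z' s)\<^sup>2) ^ 3"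
proof -
  define \<phi> where "\<phi> = twizzler_map w \<alpha>"
  define Ps :: "real \<times> real \<Rightarrow> real^3" where "Ps = (\<lambda>p. vector
    [x' (fst p) * cos (w * snd p) + z' (fst p) * sin (w * snd p), 0,
     - x' (fst p) * sin (w * snd p) + z' (fst p) * cos (w * snd p)])"
  define Pt :: "real \<times> real \<Rightarrow> real^3" where "Pt = (\<lambda>p. vector
    [w * (- x (fst p) * sin (w * snd p) + z (fst p) * cos (w * snd p)), 1,
     w * (- x (fst p) * cos (w * snd p) - z (fst p) * sin (w * snd p))])"
  have dcomp: "((\<lambda>p. f (fst p)) has_derivative (\<lambda>v. fst v * f')) (at p)"
    if "(f has_real_derivative f') (at (fst p))" for f f' and p :: "real \<times> real"
    by (rule DERIV_compose_FDERIV[OF that has_derivative_fst[OF has_derivative_ident]])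
  have dcos: "((\<lambda>p. cos (w * snd p)) has_derivative (\<lambda>v. - w * snd v * sin (w * snd p))) (at p)"
    and dsin: "((\<lambda>p. sin (w * snd p)) has_derivative (\<lambda>v. w * snd v * cos (w * snd p))) (at p)"
    for p :: "real \<times> real"
    by (auto intro!: derivative_eq_intros simp: fun_eq_iff)
  have d\<phi>: "(\<phi> has_derivative (\<lambda>v. fst v *\<^sub>R Ps p + snd v *\<^sub>R Pt p)) (at p)" for p
  proof -
    have "\<phi> = (\<lambda>p. vector
      [x (fst p) * cos (w * snd p) + z (fst p) * sin (w * snd p), snd p,
       - x (fst p) * sin (w * snd p) + z (fst p) * cos (w * snd p)])"
      by (auto simp: \<phi>_def twizzler_map_def \<alpha> fun_eq_iff)
    then show ?thesis
      apply (simp only:)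
      apply (rule has_derivative_eq_rhs)
       apply (rule has_derivative_vector_3)
         apply (rule derivative_intros dcomp d dcos dsin)+
      apply (simp add: fun_eq_iff vec_eq_iff forall_3 Ps_def Pt_def algebra_simps)
      done
  qed
  then have frechet: "frechet_derivative \<phi> (at p) = (\<lambda>v. fst v *\<^sub>R Ps p + snd v *\<^sub>R Pt p)" for p
    by (rule frechet_derivative_at[symmetric])
  define n where "n = (\<lambda>p. cross3 (Ps p) (Pt p))"
  define \<nu> where "\<nu> = surface_normal \<phi>"
  have \<nu>: "\<nu> p = n p /\<^sub>R norm (n p)" for p
    by (simp add: \<nu>_def surface_normal_def frechet n_def Let_def)
  have orth: "\<nu> p \<bullet> Ps p = 0" "\<nu> p \<bullet> Pt p = 0" for p
    by (simp_all add: \<nu> n_def dot_cross_self)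
  define p0 where "p0 = (s, 0 :: real)"
  \<comment> \<open>The derivatives of the tangents at \<open>(s, 0)\<close>, that is, the second derivatives of \<open>\<phi>\<close>.\<close>
  have dPs: "(Ps has_derivative (\<lambda>v. vector
      [x2 * fst v + w * z' s * snd v, 0, z2 * fst v - w * x' s * snd v])) (at p0)"
    unfolding Ps_def p0_def
    apply (rule has_derivative_eq_rhs)
     apply (rule has_derivative_vector_3)
       apply (rule derivative_intros dcomp d2 dcos dsin | simp only: fst_conv)+
    apply (simp add: fun_eq_iff vec_eq_iff forall_3 algebra_simps)
    done
  have dPt: "(Pt has_derivative (\<lambda>v. vector
      [w * z' s * fst v - w\<^sup>2 * x s * snd v, 0, - w * x' s * fst v - w\<^sup>2 * z s * snd v])) (at p0)"
    unfolding Pt_def p0_def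
    apply (rule has_derivative_eq_rhs)
     apply (rule has_derivative_vector_3)
       apply (rule derivative_intros dcomp d dcos dsin)+
    apply (simp add: fun_eq_iff vec_eq_iff forall_3 algebra_simps power2_eq_square)
    done
  have Ps0: "Ps p0 = vector [x' s, 0, z' s]" and Pt0: "Pt p0 = vector [w * z s, 1, - (w * x s)]"
    by (simp_all add: Ps_def Pt_def p0_def)
  define \<xi>1 where "\<xi>1 = x s * x' s + z s * z' s"
  define \<xi>2 where "\<xi>2 = x' s * z s - x s * z' s"
  have n0: "n p0 = vector [- z' s, w * \<xi>1, x' s]"
    by (simp add: n_def Ps0 Pt0 cross3_def \<xi>1_def algebra_simps)
  define D where "D = norm (n p0)"
  have "n p0 \<bullet> n p0 = ((x' s)\<^sup>2 + (z' s)\<^sup>2) + w\<^sup>2 * \<xi>1\<^sup>2"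
    by (simp add: n0 inner_vec_def sum_3 power2_eq_square algebra_simps)
  then have D: "D = sqrt (1 + w\<^sup>2 * \<xi>1\<^sup>2)"
    by (simp add: D_def norm_eq_sqrt_inner unit)
  then have "D > 0" by (simp add: add_pos_nonneg)
  have D2: "D\<^sup>2 = 1 + w\<^sup>2 * \<xi>1\<^sup>2" by (simp add: D)
  have \<nu>0: "\<nu> p0 = vector [- z' s / D, w * \<xi>1 / D, x' s / D]"
    by (simp add: \<nu> n0 D_def[symmetric, unfolded n0] vec_eq_iff forall_3 divide_inverse_commute)
  from H obtain k1 k2 N v1 v2 where N: "(\<nu> has_derivative N) (at p0)"
    and v: "v1 \<noteq> v2" "independent {v1, v2}"
    and Nv: "N v1 = - (k1 *\<^sub>R frechet_derivative \<phi> (at p0) v1)"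
       "N v2 = - (k2 *\<^sub>R frechet_derivative \<phi> (at p0) v2)"
    and k: "H = (k1 + k2) / 2"
    unfolding has_mean_curvature_def principal_curvatures_def \<phi>_def[symmetric] \<nu>_def[symmetric]
      p0_def[symmetric] by blast
  \<comment> \<open>A field that is tangent along the whole surface is orthogonal to \<open>\<nu>\<close>; differentiate that.\<close>
  have weingarten: "N v \<bullet> P p0 = - (\<nu> p0 \<bullet> P' v)"
    if "(P has_derivative P') (at p0)" "\<And>p. \<nu> p \<bullet> P p = 0" for P P' v
  proof -
    have "((\<lambda>p. \<nu> p \<bullet> P p) has_derivative (\<lambda>v. \<nu> p0 \<bullet> P' v + N v \<bullet> P p0)) (at p0)"
      using N that(1) by (rule has_derivative_inner)
    then have "((\<lambda>p. 0) has_derivative (\<lambda>v. \<nu> p0 \<bullet> P' v + N v \<bullet> P p0)) (at p0)"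
      by (simp add: that(2))
    then have "(\<lambda>v. \<nu> p0 \<bullet> P' v + N v \<bullet> P p0) = (\<lambda>v. 0)"
      using has_derivative_unique has_derivative_const by blast
    then show ?thesis by (metis add.commute add_eq_0_iff)
  qed
  define \<kappa> where "\<kappa> = x' s * z2 - z' s * x2"
  define G where "G = 1 + w\<^sup>2 * ((x s)\<^sup>2 + (z s)\<^sup>2)"
  \<comment> \<open>The entries of the second fundamental form are \<open>\<kappa> / D\<close>, \<open>- w / D\<close> and \<open>- w\<^sup>2 \<xi>2 / D\<close>.\<close>
  have Ns: "N v \<bullet> Ps p0 = - (\<kappa> / D * fst v + (- w / D) * snd v)" for v
  proof -
    have "\<nu> p0 \<bullet> vector [x2 * fst v + w * z' s * snd v, 0, z2 * fst v - w * x' s * snd v]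
        = (\<kappa> * fst v - w * ((x' s)\<^sup>2 + (z' s)\<^sup>2) * snd v) / D"
      using \<open>D > 0\<close> by (simp add: \<nu>0 inner_vec_def sum_3 \<kappa>_def field_simps power2_eq_square)
    then show ?thesis
      using weingarten[OF dPs orth(1)] \<open>D > 0\<close> by (simp add: unit field_simps)
  qed
  have Nt: "N v \<bullet> Pt p0 = - ((- w / D) * fst v + (- w\<^sup>2 * \<xi>2 / D) * snd v)" for v
  proof -
    have "\<nu> p0 \<bullet> vector [w * z' s * fst v - w\<^sup>2 * x s * snd v, 0,
            - w * x' s * fst v - w\<^sup>2 * z s * snd v]
        = (- w * ((x' s)\<^sup>2 + (z' s)\<^sup>2) * fst v - w\<^sup>2 * \<xi>2 * snd v) / D"
      using \<open>D > 0\<close> by (simp add: \<nu>0 inner_vec_def sum_3 \<xi>2_def field_simps power2_eq_square)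
    then show ?thesis
      using weingarten[OF dPt orth(2)] \<open>D > 0\<close> by (simp add: unit field_simps)
  qed
  \<comment> \<open>The entries of the first fundamental form are \<open>1\<close>, \<open>w \<xi>2\<close> and \<open>G\<close>.\<close>
  have gram: "Ps p0 \<bullet> Ps p0 = 1" "Pt p0 \<bullet> Ps p0 = w * \<xi>2" "Ps p0 \<bullet> Pt p0 = w * \<xi>2"
       "Pt p0 \<bullet> Pt p0 = G"
    using unit[of s]
    by (simp_all add: Ps0 Pt0 inner_vec_def sum_3 \<xi>2_def G_def power2_eq_square algebra_simps)
  have eigen: "k * (1 * fst v + (w * \<xi>2) * snd v) = \<kappa> / D * fst v + (- w / D) * snd v
      \<and> k * ((w * \<xi>2) * fst v + G * snd v) = (- w / D) * fst v + (- w\<^sup>2 * \<xi>2 / D) * snd v"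
    if "N v = - (k *\<^sub>R frechet_derivative \<phi> (at p0) v)" for k v
    using Ns[of v] Nt[of v] unfolding that frechet
    by (simp add: inner_left_distrib gram algebra_simps)
  have "(k1 + k2) * (1 * G - (w * \<xi>2)\<^sup>2)
      = \<kappa> / D * G - 2 * (- w / D) * (w * \<xi>2) + (- w\<^sup>2 * \<xi>2 / D) * 1"
    using eigen[OF Nv(1)] eigen[OF Nv(2)] independent_pair_det_nonzero[OF v]
    by (intro trace_of_generalized_eigenvalues) auto
  moreover have "1 * G - (w * \<xi>2)\<^sup>2 = D\<^sup>2"
  proof -
    have "\<xi>1\<^sup>2 + \<xi>2\<^sup>2 = ((x s)\<^sup>2 + (z s)\<^sup>2) * ((x' s)\<^sup>2 + (z' s)\<^sup>2)"
      unfolding \<xi>1_def \<xi>2_def by algebra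
    then have "(x s)\<^sup>2 + (z s)\<^sup>2 = \<xi>1\<^sup>2 + \<xi>2\<^sup>2" by (simp add: unit)
    then show ?thesis by (simp add: D2 G_def algebra_simps power_mult_distrib)
  qed
  moreover have "\<kappa> / D * G - 2 * (- w / D) * (w * \<xi>2) + (- w\<^sup>2 * \<xi>2 / D) * 1
      = (\<kappa> * G + w\<^sup>2 * \<xi>2) / D"
    using \<open>D > 0\<close> by (simp add: field_simps power2_eq_square)
  ultimately have "(k1 + k2) * D\<^sup>2 = (\<kappa> * G + w\<^sup>2 * \<xi>2) / D" by simp
  then have "\<kappa> * G + w\<^sup>2 * \<xi>2 = (k1 + k2) * D\<^sup>2 * D"
    using \<open>D > 0\<close> by (simp add: eq_divide_eq)
  then have "\<kappa> * G + w\<^sup>2 * \<xi>2 = 2 * H * D ^ 3"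
    by (simp add: k power2_eq_square power3_eq_cube)
  then show ?thesis unfolding \<kappa>_def G_def D \<xi>1_def \<xi>2_def .
qed

section \<open>The TreadmillSled as a solution of a differential equation\<close>

text \<open>The isometry of the TreadmillSled at time \<open>s\<close> is \<open>p \<mapsto> R0 (p - \<alpha> s)\<close>, where \<open>R0\<close> is the rotation with
rows \<open>\<alpha>'\<close> and the quarter turn of \<open>\<alpha>'\<close>. It is the only one: a rotation is determined by its first row, and two
unit vectors with inner product \<open>1\<close> (the first row of \<open>R\<close> and \<open>\<alpha>'\<close>) coincide.\<close>

lemma treadmill_sled_coordinates:
  fixes \<alpha> :: "real \<Rightarrow> real^2"
  defines "d s \<equiv> vector_derivative \<alpha> (at s)"
  assumes unit: "(d s $ 1)\<^sup>2 + (d s $ 2)\<^sup>2 = 1"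
  shows "(- treadmill_sled \<alpha> s) $ 1 = \<alpha> s $ 1 * d s $ 1 + \<alpha> s $ 2 * d s $ 2"
    and "(- treadmill_sled \<alpha> s) $ 2 = d s $ 1 * \<alpha> s $ 2 - \<alpha> s $ 1 * d s $ 2"
proof -
  define R0 :: "real^2^2" where
    "R0 = vector [vector [d s $ 1, d s $ 2], vector [- d s $ 2, d s $ 1]]"
  have R0: "rotation_matrix R0" "R0 *v d s = vector [1, 0]"
    using unit
    by (simp_all add: rotation_matrix_def orthogonal_matrix R0_def det_2 matrix_matrix_mult_def
        matrix_vector_mult_def transpose_def mat_def sum_2 vec_eq_iff forall_2 power2_eq_square
        algebra_simps)
  have unique: "R = R0" if "rotation_matrix R" and Rd: "R *v d s = vector [1, 0]" for R :: "real^2^2"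
  proof -
    have rows: "(R$1$1)\<^sup>2 + (R$1$2)\<^sup>2 = 1" "(R$2$1)\<^sup>2 + (R$2$2)\<^sup>2 = 1"
      and det: "R$1$1 * R$2$2 - R$1$2 * R$2$1 = 1"
      using \<open>rotation_matrix R\<close>
      by (simp_all add: rotation_matrix_def orthogonal_matrix_def det_2 matrix_matrix_mult_def
          transpose_def mat_def sum_2 vec_eq_iff forall_2 power2_eq_square)
    have R1d: "R$1$1 * d s $ 1 + R$1$2 * d s $ 2 = 1"
      using Rd by (simp add: matrix_vector_mult_def sum_2 vec_eq_iff forall_2)
    have "(R$2$1 + R$1$2)\<^sup>2 + (R$2$2 - R$1$1)\<^sup>2 = 0"
      using rows det by algebra
    moreover have "(R$1$1 - d s $ 1)\<^sup>2 + (R$1$2 - d s $ 2)\<^sup>2 = 0"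
      using rows(1) unit R1d by algebra
    ultimately show ?thesis
      by (simp add: R0_def vec_eq_iff forall_2 sum_power2_eq_zero_iff)
  qed
  have "treadmill_isometry \<alpha> s = (\<lambda>p. R0 *v p + - (R0 *v \<alpha> s))"
    unfolding treadmill_isometry_def
  proof (rule the_equality)
    fix T
    assume "\<exists>R c. rotation_matrix R \<and> T = (\<lambda>p. R *v p + c) \<and> T (\<alpha> s) = 0 \<and>
      R *v vector_derivative \<alpha> (at s) = vector [1, 0]"
    then obtain R c where "rotation_matrix R" "T = (\<lambda>p. R *v p + c)" "T (\<alpha> s) = 0"
      "R *v d s = vector [1, 0]" unfolding d_def by blast
    with unique[of R] show "T = (\<lambda>p. R0 *v p + - (R0 *v \<alpha> s))"
      by (simp add: fun_eq_iff eq_neg_iff_add_eq_0 add.commute[of _ c])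
  next
    show "\<exists>R c. rotation_matrix R \<and> (\<lambda>p. R0 *v p + - (R0 *v \<alpha> s)) = (\<lambda>p. R *v p + c) \<and>
      R0 *v \<alpha> s + - (R0 *v \<alpha> s) = 0 \<and> R *v vector_derivative \<alpha> (at s) = vector [1, 0]"
      using R0 unfolding d_def by (intro exI[of _ R0] exI[of _ "- (R0 *v \<alpha> s)"]) simp
  qed
  then have "- treadmill_sled \<alpha> s = R0 *v \<alpha> s"
    by (simp add: treadmill_sled_def)
  then show "(- treadmill_sled \<alpha> s) $ 1 = \<alpha> s $ 1 * d s $ 1 + \<alpha> s $ 2 * d s $ 2"
    and "(- treadmill_sled \<alpha> s) $ 2 = d s $ 1 * \<alpha> s $ 2 - \<alpha> s $ 1 * d s $ 2"
    by (simp_all only: R0_def) (simp_all add: matrix_vector_mult_def sum_2 algebra_simps)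
qed

lemma flow_field_via_sqrt:
  "f1 w x1 x2 = (- (w\<^sup>2) * x2 + 2 * sqrt (1 + w\<^sup>2 * x1\<^sup>2) ^ 3) / (1 + w\<^sup>2 * (x1\<^sup>2 + x2\<^sup>2)) * x2 + 1"
  "f2 w x1 x2 = (w\<^sup>2 * x2 - 2 * sqrt (1 + w\<^sup>2 * x1\<^sup>2) ^ 3) / (1 + w\<^sup>2 * (x1\<^sup>2 + x2\<^sup>2)) * x1"
proof -
  have pos: "1 + w\<^sup>2 * x1\<^sup>2 > 0" by (simp add: add_pos_nonneg)
  have "(1 + w\<^sup>2 * x1\<^sup>2) powr (3/2) = ((1 + w\<^sup>2 * x1\<^sup>2) powr (1/2)) powr 3"
    by (simp add: powr_powr)
  also have "\<dots> = sqrt (1 + w\<^sup>2 * x1\<^sup>2) ^ 3"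
    using pos by (simp add: powr_half_sqrt powr_realpow[of _ 3, simplified])
  finally have "(1 + w\<^sup>2 * x1\<^sup>2) powr (3/2) = sqrt (1 + w\<^sup>2 * x1\<^sup>2) ^ 3" .
  then show "f1 w x1 x2 = (- (w\<^sup>2) * x2 + 2 * sqrt (1 + w\<^sup>2 * x1\<^sup>2) ^ 3) / (1 + w\<^sup>2 * (x1\<^sup>2 + x2\<^sup>2)) * x2 + 1"
    and "f2 w x1 x2 = (w\<^sup>2 * x2 - 2 * sqrt (1 + w\<^sup>2 * x1\<^sup>2) ^ 3) / (1 + w\<^sup>2 * (x1\<^sup>2 + x2\<^sup>2)) * x1"
    by (simp_all add: f1_def f2_def)
qed

text \<open>The vector \<open>\<xi>\<close> consists of the coordinates of \<open>\<alpha>\<close> in its moving frame. By the Frenet equations it satisfies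
\<open>\<xi>1' = 1 + \<kappa> \<xi>2\<close> and \<open>\<xi>2' = - \<kappa> \<xi>1\<close>, with \<open>\<kappa>\<close> the curvature of \<open>\<alpha>\<close>. Mean curvature \<open>1\<close> expresses
\<open>\<kappa>\<close> through \<open>\<xi>\<close>, and the result is the vector field \<open>(f\<^sub>1, f\<^sub>2)\<close>.\<close>

lemma twizzler_flow_equation:
  assumes tw: "twizzler_profile w 1 \<alpha>"
  defines "\<xi> \<equiv> \<lambda>s. - treadmill_sled \<alpha> s"
  shows "((\<lambda>s. \<xi> s $ 1) has_real_derivative f1 w (\<xi> s $ 1) (\<xi> s $ 2)) (at s)"
    and "((\<lambda>s. \<xi> s $ 2) has_real_derivative f2 w (\<xi> s $ 1) (\<xi> s $ 2)) (at s)"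
proof -
  define d where "d = (\<lambda>s. vector_derivative \<alpha> (at s))"
  define e where "e = (\<lambda>s. vector_derivative d (at s))"
  have C2: "\<alpha> C1_differentiable_on UNIV" "d C1_differentiable_on UNIV"
    using tw unfolding d_def twizzler_profile_def twice_cont_differentiable_def by blast+
  have "(\<alpha> has_vector_derivative d s) (at s)" "(d has_vector_derivative e s) (at s)" for s
    using C2 unfolding C1_differentiable_on_eq d_def e_def
    by (simp_all add: vector_derivative_works[symmetric])
  then have D: "((\<lambda>s. \<alpha> s $ i) has_real_derivative d s $ i) (at s)"
    and D2: "((\<lambda>s. d s $ i) has_real_derivative e s $ i) (at s)" for s and i :: 2
    unfolding has_real_derivative_iff_has_vector_derivative
    by (auto intro: bounded_linear.has_vector_derivative[OF bounded_linear_vec_nth])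
  have unit: "(d s $ 1)\<^sup>2 + (d s $ 2)\<^sup>2 = 1" for s
  proof -
    have "norm (d s) = 1"
      using tw unfolding d_def twizzler_profile_def arc_length_parametrized_def by blast
    then have "d s \<bullet> d s = 1" by (simp add: norm_eq_1)
    then show ?thesis by (simp add: inner_vec_def sum_2 power2_eq_square)
  qed
  have \<xi>: "\<xi> r $ 1 = \<alpha> r $ 1 * d r $ 1 + \<alpha> r $ 2 * d r $ 2"
     "\<xi> r $ 2 = d r $ 1 * \<alpha> r $ 2 - \<alpha> r $ 1 * d r $ 2" for r
    using treadmill_sled_coordinates[of \<alpha> r] unit[of r] unfolding \<xi>_def d_def by auto
  define \<kappa> where "\<kappa> = d s $ 1 * e s $ 2 - d s $ 2 * e s $ 1"
  have "((\<lambda>s. (d s $ 1)\<^sup>2 + (d s $ 2)\<^sup>2) has_real_derivative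
          2 * (d s $ 1 * e s $ 1 + d s $ 2 * e s $ 2)) (at s)"
    using D2[of _ s] by (auto intro!: derivative_eq_intros)
  then have "((\<lambda>s. 1) has_real_derivative 2 * (d s $ 1 * e s $ 1 + d s $ 2 * e s $ 2)) (at s)"
    unfolding unit .
  then have "2 * (d s $ 1 * e s $ 1 + d s $ 2 * e s $ 2) = 0"
    using DERIV_unique DERIV_const by blast
  then have tangent: "d s $ 1 * e s $ 1 + d s $ 2 * e s $ 2 = 0" by simp
  have frenet: "e s $ 1 = - \<kappa> * d s $ 2" "e s $ 2 = \<kappa> * d s $ 1"
    using tangent unit[of s] unfolding \<kappa>_def by algebra+
  have "has_mean_curvature (twizzler_map w \<alpha>) (s, 0) 1"
    using tw unfolding twizzler_profile_def by blast
  from twizzler_mean_curvature_equation[OF refl refl D D D2 D2 unit this]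
  have eq: "\<kappa> * (1 + w\<^sup>2 * ((\<alpha> s $ 1)\<^sup>2 + (\<alpha> s $ 2)\<^sup>2)) + w\<^sup>2 * \<xi> s $ 2
      = 2 * sqrt (1 + w\<^sup>2 * (\<xi> s $ 1)\<^sup>2) ^ 3"
    by (simp add: \<kappa>_def \<xi>)
  have "(\<alpha> s $ 1)\<^sup>2 + (\<alpha> s $ 2)\<^sup>2 = (\<xi> s $ 1)\<^sup>2 + (\<xi> s $ 2)\<^sup>2"
    using unit[of s] unfolding \<xi> by algebra
  with eq have eq': "\<kappa> * (1 + w\<^sup>2 * ((\<xi> s $ 1)\<^sup>2 + (\<xi> s $ 2)\<^sup>2)) + w\<^sup>2 * \<xi> s $ 2
      = 2 * sqrt (1 + w\<^sup>2 * (\<xi> s $ 1)\<^sup>2) ^ 3" by simp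
  have pos: "1 + w\<^sup>2 * ((\<xi> s $ 1)\<^sup>2 + (\<xi> s $ 2)\<^sup>2) > 0" by (intro add_pos_nonneg) auto
  have \<kappa>: "\<kappa> = (- (w\<^sup>2) * \<xi> s $ 2 + 2 * sqrt (1 + w\<^sup>2 * (\<xi> s $ 1)\<^sup>2) ^ 3)
      / (1 + w\<^sup>2 * ((\<xi> s $ 1)\<^sup>2 + (\<xi> s $ 2)\<^sup>2))"
    unfolding eq'[symmetric] using pos by simp
  have "f1 w (\<xi> s $ 1) (\<xi> s $ 2) = \<kappa> * \<xi> s $ 2 + 1"
    by (simp add: flow_field_via_sqrt \<kappa>)
  also have "\<dots> = (d s $ 1 * d s $ 1 + \<alpha> s $ 1 * e s $ 1) + (d s $ 2 * d s $ 2 + \<alpha> s $ 2 * e s $ 2)"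
    using unit[of s] unfolding frenet \<xi> by algebra
  finally show "((\<lambda>s. \<xi> s $ 1) has_real_derivative f1 w (\<xi> s $ 1) (\<xi> s $ 2)) (at s)"
    unfolding \<xi>(1)[abs_def] using D[of _ s] D2[of _ s]
    by (auto intro!: derivative_eq_intros)
  have "f2 w (\<xi> s $ 1) (\<xi> s $ 2) = - \<kappa> * \<xi> s $ 1"
    by (simp add: flow_field_via_sqrt \<kappa> minus_divide_left)
  also have "\<dots> = (e s $ 1 * \<alpha> s $ 2 + d s $ 1 * d s $ 2) - (d s $ 1 * d s $ 2 + \<alpha> s $ 1 * e s $ 2)"
    unfolding frenet \<xi> by algebra
  finally show "((\<lambda>s. \<xi> s $ 2) has_real_derivative f2 w (\<xi> s $ 1) (\<xi> s $ 2)) (at s)"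
    unfolding \<xi>(2)[abs_def] using D[of _ s] D2[of _ s]
    by (auto intro!: derivative_eq_intros)
qed

section \<open>The level curve and its parametrization\<close>

text \<open>On the level curve, put \<open>Y = x1\<^sup>2\<close>; completing the square in \<open>x2\<close> gives
\<open>(2 D x2 + 1)\<^sup>2 = 1 + 4 M + 4 (w\<^sup>2 M - 1) Y - 4 w\<^sup>2 Y\<^sup>2\<close> with \<open>D = sqrt (1 + w\<^sup>2 Y)\<close>. The number \<open>A\<^sup>2\<close>
is the positive root of the right-hand side; the other root is negative because the product of
the roots is \<open>- (1 + 4 M) / (4 w\<^sup>2)\<close>. The second claim is the equation of the root, and the
third shows where \<open>B\<close> comes from: at \<open>Y = A\<^sup>2 cos\<^sup>2 u\<close> the quadratic polynomial factors as
\<open>(1 + 4 M + B cos\<^sup>2 u) sin\<^sup>2 u\<close>.\<close>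

lemma level_curve_constants:
  assumes M: "M > - 1 / 4" and w: "w > 0"
  shows "A M w > 0" and "w\<^sup>2 * (A M w) ^ 4 = (w\<^sup>2 * M - 1) * (A M w)\<^sup>2 + (1 + 4 * M) / 4"
    and "B M w = 4 * w\<^sup>2 * (A M w) ^ 4"
proof -
  define R where "R = sqrt (1 + (1 + 2*M) * w\<^sup>2 + M\<^sup>2 * w ^ 4)"
  \<comment> \<open>The discriminant of the quadratic polynomial, up to a constant factor.\<close>
  have disc: "1 + (1 + 2*M) * w\<^sup>2 + M\<^sup>2 * w ^ 4 = (M * w\<^sup>2 - 1)\<^sup>2 + w\<^sup>2 * (1 + 4 * M)"
    by (simp add: power2_eq_square power4_eq_xxxx algebra_simps)
  have pos: "w\<^sup>2 * (1 + 4 * M) > 0" using M w by simp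
  then have R2: "R\<^sup>2 = (M * w\<^sup>2 - 1)\<^sup>2 + w\<^sup>2 * (1 + 4 * M)"
    unfolding R_def disc by (simp add: add_nonneg_nonneg less_imp_le)
  have "\<bar>M * w\<^sup>2 - 1\<bar> < R"
  proof (rule power2_less_imp_less)
    show "\<bar>M * w\<^sup>2 - 1\<bar>\<^sup>2 < R\<^sup>2" using pos by (simp add: R2)
    show "0 \<le> R" unfolding R_def disc using pos by simp
  qed
  then have num: "- 1 + M * w\<^sup>2 + R > 0" by simp
  show "A M w > 0" unfolding A_def R_def[symmetric] using num w by simp
  have A2: "2 * w\<^sup>2 * (A M w)\<^sup>2 = - 1 + M * w\<^sup>2 + R"
    unfolding A_def R_def[symmetric] using num w by (simp add: power_divide power_mult_distrib)
  have A4: "(A M w) ^ 4 = ((A M w)\<^sup>2)\<^sup>2" by simp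
  have "4 * w\<^sup>2 * (w\<^sup>2 * (A M w) ^ 4) = 4 * w\<^sup>2 * ((w\<^sup>2 * M - 1) * (A M w)\<^sup>2 + (1 + 4 * M) / 4)"
    using A2 R2 unfolding A4 by algebra
  then show "w\<^sup>2 * (A M w) ^ 4 = (w\<^sup>2 * M - 1) * (A M w)\<^sup>2 + (1 + 4 * M) / 4"
    using w by simp
  have "w\<^sup>2 * B M w = 2 + 2 * M\<^sup>2 * w ^ 4 + w\<^sup>2 + 2 * (M * w\<^sup>2 - 1) * R"
    unfolding B_def R_def using w by simp
  also have "\<dots> = (2 * w\<^sup>2 * (A M w)\<^sup>2)\<^sup>2"
    using R2 unfolding A2 by algebra
  also have "\<dots> = w\<^sup>2 * (4 * w\<^sup>2 * (A M w) ^ 4)"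
    by (simp add: power2_eq_square power4_eq_xxxx)
  finally show "B M w = 4 * w\<^sup>2 * (A M w) ^ 4" using w by simp
qed

text \<open>The map \<open>u \<mapsto> (\<rho>\<^sub>1(u), \<rho>\<^sub>2(u))\<close> is inverted by reading off \<open>cos u\<close> and \<open>sin u\<close> from the point.
The term \<open>4 w\<^sup>2 A\<^sup>2 x1\<^sup>2\<close> is \<open>B cos\<^sup>2 u\<close> for \<open>x1 = A cos u\<close>.\<close>

definition level_cos :: "real \<Rightarrow> real \<Rightarrow> real \<Rightarrow> real" where
  "level_cos M w x1 = x1 / A M w"

definition level_sin :: "real \<Rightarrow> real \<Rightarrow> real \<Rightarrow> real \<Rightarrow> real" where
  "level_sin M w x1 x2 =
     (2 * sqrt (1 + w\<^sup>2 * x1\<^sup>2) * x2 + 1) / sqrt (1 + 4 * M + 4 * w\<^sup>2 * (A M w)\<^sup>2 * x1\<^sup>2)"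

text \<open>This is the factorization \<open>A\<^sup>2 (2 D x2 + 1)\<^sup>2 = (1 + 4 M + 4 w\<^sup>2 A\<^sup>2 x1\<^sup>2) (A\<^sup>2 - x1\<^sup>2)\<close> of the quadratic
polynomial whose positive root is \<open>A\<^sup>2\<close>.\<close>

lemma level_curve_unit_circle:
  assumes M: "M > - 1 / 4" and w: "w > 0" and p: "p \<in> level_curve w M"
  shows "(level_cos M w (p$1))\<^sup>2 + (level_sin M w (p$1) (p$2))\<^sup>2 = 1"
proof -
  define D where "D = sqrt (1 + w\<^sup>2 * (p$1)\<^sup>2)"
  define Q where "Q = 1 + 4 * M + 4 * w\<^sup>2 * (A M w)\<^sup>2 * (p$1)\<^sup>2"
  have D: "D > 0" "D\<^sup>2 = 1 + w\<^sup>2 * (p$1)\<^sup>2" by (simp_all add: D_def add_pos_nonneg)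
  have Q: "Q > 0" unfolding Q_def by (rule add_pos_nonneg) (use M in auto)
  have "(p$1)\<^sup>2 + (p$2)\<^sup>2 + p$2 / D = M"
    using p by (simp add: level_curve_def h_def D_def)
  then have "((p$1)\<^sup>2 + (p$2)\<^sup>2) * D + p$2 = M * D" using D by (simp add: field_simps)
  then have "(2 * D * p$2 + 1)\<^sup>2 = 4 * D\<^sup>2 * (M - (p$1)\<^sup>2) + 1" by algebra
  also have "(A M w)\<^sup>2 * \<dots> = Q * ((A M w)\<^sup>2 - (p$1)\<^sup>2)"
    unfolding D Q_def using level_curve_constants(2)[OF M w] by algebra
  finally have "(A M w)\<^sup>2 * (2 * D * p$2 + 1)\<^sup>2 = Q * ((A M w)\<^sup>2 - (p$1)\<^sup>2)" .
  moreover have "Q * (level_sin M w (p$1) (p$2))\<^sup>2 = (2 * D * p$2 + 1)\<^sup>2"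
    using Q by (simp add: level_sin_def D_def[symmetric] Q_def[symmetric] power_divide)
  moreover have "(A M w)\<^sup>2 * (level_cos M w (p$1))\<^sup>2 = (p$1)\<^sup>2"
    using level_curve_constants(1)[OF M w] by (simp add: level_cos_def power_divide)
  ultimately have "((A M w)\<^sup>2 * Q)
      * ((level_cos M w (p$1))\<^sup>2 + (level_sin M w (p$1) (p$2))\<^sup>2) = (A M w)\<^sup>2 * Q"
    by algebra
  then show ?thesis using Q level_curve_constants(1)[OF M w] by simp
qed

lemma level_curve_parametrization:
  assumes M: "M > - 1 / 4" and w: "w > 0"
    and c: "level_cos M w x1 = cos u" and s: "level_sin M w x1 x2 = sin u"
  shows "x1 = \<rho>1 M w u" and "x2 = \<rho>2 M w u"
proof -
  note A = level_curve_constants[OF M w]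
  show x1: "x1 = \<rho>1 M w u" using c A(1) by (simp add: level_cos_def \<rho>1_def field_simps)
  define D where "D = sqrt (1 + w\<^sup>2 * x1\<^sup>2)"
  define Q where "Q = 1 + 4 * M + 4 * w\<^sup>2 * (A M w)\<^sup>2 * x1\<^sup>2"
  have D: "D > 0" by (simp add: D_def add_pos_nonneg)
  have Q: "Q > 0" unfolding Q_def by (rule add_pos_nonneg) (use M in auto)
  have D': "sqrt (1 + w\<^sup>2 * (A M w)\<^sup>2 * (cos u)\<^sup>2) = D"
    by (simp add: D_def x1 \<rho>1_def power_mult_distrib)
  have Q': "1 + 4 * M + B M w * (cos u)\<^sup>2 = Q"
    unfolding A(3) by (simp add: Q_def x1 \<rho>1_def power2_eq_square power4_eq_xxxx)
  have "2 * D * x2 + 1 = sqrt Q * sin u"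
    using s Q unfolding level_sin_def D_def[symmetric] Q_def[symmetric] by (simp add: field_simps)
  then show "x2 = \<rho>2 M w u"
    unfolding \<rho>2_def D' Q' using D by (simp add: field_simps)
qed

text \<open>The only rest point of the flow is \<open>(0, -1/2)\<close>, where the profile curve is a circle about the
origin (the Twizzler is a cylinder). It lies on the level \<open>M = -1/4\<close>.\<close>

lemma flow_field_nonzero_on_level_curve:
  assumes M: "M > - 1 / 4" and p: "p \<in> level_curve w M"
  shows "(f1 w (p$1) (p$2))\<^sup>2 + (f2 w (p$1) (p$2))\<^sup>2 > 0"
proof (rule ccontr)
  assume "\<not> ?thesis"
  then have f: "f1 w (p$1) (p$2) = 0" "f2 w (p$1) (p$2) = 0"
    using sum_power2_gt_zero_iff by blast+
  define G where "G = 1 + w\<^sup>2 * ((p$1)\<^sup>2 + (p$2)\<^sup>2)"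
  define k where "k = (- (w\<^sup>2) * p$2 + 2 * sqrt (1 + w\<^sup>2 * (p$1)\<^sup>2) ^ 3) / G"
  have G: "G > 0" unfolding G_def by (intro add_pos_nonneg) auto
  have "k * p$2 + 1 = 0" using f(1) by (simp add: flow_field_via_sqrt k_def G_def)
  moreover have "k * p$1 = 0"
    using f(2) G by (auto simp: flow_field_via_sqrt k_def G_def)
  ultimately have p1: "p$1 = 0" by auto
  have "(- (w\<^sup>2) * p$2 + 2) * p$2 + G = 0"
    using \<open>k * p$2 + 1 = 0\<close> G by (simp add: k_def p1 field_simps)
  then have "p$2 = - 1 / 2"
    by (simp add: G_def p1 power2_eq_square algebra_simps)
  then have "h w p = - 1 / 4" by (simp add: h_def p1 power2_eq_square)
  with p M show False by (simp add: level_curve_def)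
qed

lemma parametrization_differentiable:
  assumes M: "M > - 1 / 4" and w: "w > 0"
  shows "(\<rho>1 M w has_real_derivative deriv (\<rho>1 M w) u) (at u)"
    and "(\<rho>2 M w has_real_derivative deriv (\<rho>2 M w) u) (at u)"
proof -
  have "\<exists>D. (\<rho>1 M w has_real_derivative D) (at u)"
    unfolding \<rho>1_def by (rule exI) (auto intro!: derivative_eq_intros)
  then show "(\<rho>1 M w has_real_derivative deriv (\<rho>1 M w) u) (at u)"
    by (metis DERIV_imp_deriv)
  have Q: "1 + 4 * M + B M w * (cos u)\<^sup>2 > 0"
    by (rule add_pos_nonneg) (use M level_curve_constants[OF M w] in auto)
  have D: "1 + w\<^sup>2 * (A M w)\<^sup>2 * (cos u)\<^sup>2 > 0" by (intro add_pos_nonneg) auto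
  have "\<exists>D. (\<rho>2 M w has_real_derivative D) (at u)"
    unfolding \<rho>2_def using Q D
    by (intro exI) (rule derivative_eq_intros refl | simp)+
  then show "(\<rho>2 M w has_real_derivative deriv (\<rho>2 M w) u) (at u)"
    by (metis DERIV_imp_deriv)
qed

lemma deriv_periodic:
  fixes f :: "real \<Rightarrow> real"
  assumes "\<And>x. f (x + p) = f x"
  shows "deriv f (x + p) = deriv f x"
proof -
  have "(f has_real_derivative D) (at (x + p)) \<longleftrightarrow> (f has_real_derivative D) (at x)" for D
    using DERIV_shift[of f D x p] assms by simp
  then show ?thesis by (simp add: deriv_def)
qed

lemma length_density_periodic:
  "lam M w (u + 2 * pi) = lam M w u" "mu M w (u + 2 * pi) = mu M w u"
proof -
  have \<rho>: "\<rho>1 M w (x + 2 * pi) = \<rho>1 M w x" "\<rho>2 M w (x + 2 * pi) = \<rho>2 M w x" for x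
    by (simp_all add: \<rho>1_def \<rho>2_def)
  show "lam M w (u + 2 * pi) = lam M w u"
    by (simp add: lam_def deriv_periodic[of "\<rho>1 M w", OF \<rho>(1)] deriv_periodic[of "\<rho>2 M w", OF \<rho>(2)])
  show "mu M w (u + 2 * pi) = mu M w u" by (simp add: mu_def \<rho>)
qed

section \<open>The length of a fundamental piece\<close>

text \<open>The coordinates \<open>level_cos\<close> and \<open>level_sin\<close> turn a solution on the level curve into a path on the unit
circle. Writing out its velocity shows that the velocity is continuous, which is what the angle
lift requires.\<close>

lemma level_curve_angle_lift:
  fixes X Y :: "real \<Rightarrow> real"
  assumes M: "M > - 1 / 4" and w: "w > 0" and "a < b"
    and dX: "\<And>s. (X has_real_derivative f1 w (X s) (Y s)) (at s)"
    and dY: "\<And>s. (Y has_real_derivative f2 w (X s) (Y s)) (at s)"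
    and level: "\<And>s. vector [X s, Y s] \<in> level_curve w M"
  obtains u u' where
    "\<And>s. s \<in> {a..b} \<Longrightarrow> (u has_real_derivative u' s) (at s within {a..b})"
    "continuous_on {a..b} u'"
    "\<And>s. s \<in> {a..b} \<Longrightarrow> level_cos M w (X s) = cos (u s)"
    "\<And>s. s \<in> {a..b} \<Longrightarrow> level_sin M w (X s) (Y s) = sin (u s)"
proof -
  define D where "D = (\<lambda>s. sqrt (1 + w\<^sup>2 * (X s)\<^sup>2))"
  define Q where "Q = (\<lambda>s. sqrt (1 + 4 * M + 4 * w\<^sup>2 * (A M w)\<^sup>2 * (X s)\<^sup>2))"
  define F where "F = (\<lambda>s. f1 w (X s) (Y s))"
  define G where "G = (\<lambda>s. f2 w (X s) (Y s))"
  note A = level_curve_constants(1)[OF M w]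
  have Dpos: "1 + w\<^sup>2 * (X s)\<^sup>2 > 0" for s by (intro add_pos_nonneg) auto
  have Qpos: "1 + 4 * M + 4 * w\<^sup>2 * (A M w)\<^sup>2 * (X s)\<^sup>2 > 0" for s
    by (rule add_pos_nonneg) (use M in auto)
  have nz: "D s \<noteq> 0" "Q s \<noteq> 0" for s using Dpos[of s] Qpos[of s] by (simp_all add: D_def Q_def)
  have dX': "(X has_real_derivative F s) (at s)" and dY': "(Y has_real_derivative G s) (at s)" for s
    using dX dY by (simp_all add: F_def G_def)
  have dD: "(D has_real_derivative w\<^sup>2 * X s * F s / D s) (at s)" for s
    unfolding D_def using Dpos[of s]
    by (auto intro!: derivative_eq_intros dX' simp: field_simps)
  have dQ: "(Q has_real_derivative 4 * w\<^sup>2 * (A M w)\<^sup>2 * X s * F s / Q s) (at s)" for s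
    unfolding Q_def using Qpos[of s]
    by (auto intro!: derivative_eq_intros dX' simp: field_simps)
  \<comment> \<open>The velocity on the unit circle, by the quotient rule.\<close>
  define c' where "c' = (\<lambda>s. F s / A M w)"
  define S' where "S' = (\<lambda>s. (2 * (w\<^sup>2 * X s * F s / D s * Y s + D s * G s) * Q s
     - (2 * D s * Y s + 1) * (4 * w\<^sup>2 * (A M w)\<^sup>2 * X s * F s / Q s)) / (Q s * Q s))"
  have c: "((\<lambda>s. level_cos M w (X s)) has_real_derivative c' s) (at s within {a..b})" for s
    unfolding level_cos_def c'_def using A
    by (auto intro!: derivative_eq_intros DERIV_subset[OF dX'])
  have S: "((\<lambda>s. level_sin M w (X s) (Y s)) has_real_derivative S' s) (at s within {a..b})" for s
  proof -
    have "((\<lambda>s. (2 * D s * Y s + 1) / Q s) has_real_derivative S' s) (at s)"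
      unfolding S'_def using nz(2)
      by (auto intro!: derivative_eq_intros dD dQ dY' simp: algebra_simps)
    then show ?thesis
      unfolding level_sin_def D_def Q_def by (rule has_field_derivative_at_within)
  qed
  have cont: "continuous_on {a..b} X" "continuous_on {a..b} Y"
    using dX' dY' by (meson DERIV_continuous_on has_field_derivative_at_within)+
  have pos: "1 + w\<^sup>2 * ((X s)\<^sup>2 + (Y s)\<^sup>2) \<noteq> 0" for s
    using add_pos_nonneg[of 1 "w\<^sup>2 * ((X s)\<^sup>2 + (Y s)\<^sup>2)"] by simp
  have contFG: "continuous_on {a..b} F" "continuous_on {a..b} G"
    unfolding F_def G_def flow_field_via_sqrt using cont pos
    by (intro continuous_intros; simp)+
  have contDQ: "continuous_on {a..b} D" "continuous_on {a..b} Q"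
    unfolding D_def Q_def using cont by (auto intro!: continuous_intros)
  have cont': "continuous_on {a..b} c'" "continuous_on {a..b} S'"
    unfolding c'_def S'_def using cont contFG contDQ nz A by (intro continuous_intros; simp)+
  have unit: "(level_cos M w (X s))\<^sup>2 + (level_sin M w (X s) (Y s))\<^sup>2 = 1" for s
    using level_curve_unit_circle[OF M w level[of s]] by simp
  show ?thesis
    using unit_circle_lift[OF \<open>a < b\<close> c S cont' unit] that by blast
qed

theorem lemma1p7:
  fixes M v w a b :: real and \<alpha> :: "real \<Rightarrow> real^2"
  assumes "M > - 1/4" and "0 < v" and "v < 1"
    and "w > 0" and "v = 1 / (1 + w^2)"
    and "twizzler_MV_profile M v \<alpha>"
    and "fundamental_piece w M \<alpha> a b"
  shows "((\<lambda>u. sqrt (lam M w u / mu M w u)) has_integral curve_length \<alpha> a b) {0..2 * pi}"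
proof -
  note M = \<open>M > - 1/4\<close> and w = \<open>w > 0\<close>
  have w_eq: "sqrt ((1 - v) / v) = w"
  proof -
    have "1 + w\<^sup>2 > 0" by (intro add_pos_nonneg) auto
    then have "(1 - v) / v = w\<^sup>2" unfolding \<open>v = 1 / (1 + w^2)\<close> by (simp add: field_simps)
    then show ?thesis using w by simp
  qed
  have tw: "twizzler_profile w 1 \<alpha>" and on_level: "- treadmill_sled \<alpha> s \<in> level_curve w M" for s
    using \<open>twizzler_MV_profile M v \<alpha>\<close> unfolding twizzler_MV_profile_def w_eq Let_def by blast+
  have "a < b" and bij: "bij_betw (treadmill_sled \<alpha>) {a..<b} (uminus ` level_curve w M)"
    and ends: "treadmill_sled \<alpha> b = treadmill_sled \<alpha> a"
    using \<open>fundamental_piece w M \<alpha> a b\<close> unfolding fundamental_piece_def by blast+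
  define X where "X = (\<lambda>s. (- treadmill_sled \<alpha> s) $ 1)"
  define Y where "Y = (\<lambda>s. (- treadmill_sled \<alpha> s) $ 2)"
  have dX: "(X has_real_derivative f1 w (X s) (Y s)) (at s)"
    and dY: "(Y has_real_derivative f2 w (X s) (Y s)) (at s)" for s
    using twizzler_flow_equation[OF tw, of s] unfolding X_def Y_def by auto
  have XY: "vector [X s, Y s] = - treadmill_sled \<alpha> s" for s
    by (simp add: X_def Y_def vec_eq_iff forall_2)
  have level: "vector [X s, Y s] \<in> level_curve w M" for s
    using on_level by (simp add: XY)
  obtain u u' where
    du: "\<And>s. s \<in> {a..b} \<Longrightarrow> (u has_real_derivative u' s) (at s within {a..b})"
    and cont': "continuous_on {a..b} u'"
    and cos: "\<And>s. s \<in> {a..b} \<Longrightarrow> level_cos M w (X s) = cos (u s)"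
    and sin: "\<And>s. s \<in> {a..b} \<Longrightarrow> level_sin M w (X s) (Y s) = sin (u s)"
    using level_curve_angle_lift[OF M w \<open>a < b\<close> dX dY level] by blast
  have \<rho>: "X s = \<rho>1 M w (u s)" "Y s = \<rho>2 M w (u s)" if "s \<in> {a..b}" for s
    using level_curve_parametrization[OF M w cos[OF that] sin[OF that]] .
  \<comment> \<open>Compare the velocities of \<open>\<xi>\<close> and of the parametrization run through with angle \<open>u\<close>.\<close>
  have speed: "lam M w (u s) * (u' s)\<^sup>2 = mu M w (u s)" "mu M w (u s) > 0" if s: "s \<in> {a..b}" for s
  proof -
    have "((\<lambda>s. \<rho>1 M w (u s)) has_real_derivative deriv (\<rho>1 M w) (u s) * u' s) (at s within {a..b})"
      by (rule DERIV_chain2[OF parametrization_differentiable(1)[OF M w] du[OF s]])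
    from real_derivative_unique_on_Icc[OF \<open>a < b\<close> s \<rho>(1) has_field_derivative_at_within[OF dX] this]
    have X': "f1 w (X s) (Y s) = deriv (\<rho>1 M w) (u s) * u' s" .
    have "((\<lambda>s. \<rho>2 M w (u s)) has_real_derivative deriv (\<rho>2 M w) (u s) * u' s) (at s within {a..b})"
      by (rule DERIV_chain2[OF parametrization_differentiable(2)[OF M w] du[OF s]])
    from real_derivative_unique_on_Icc[OF \<open>a < b\<close> s \<rho>(2) has_field_derivative_at_within[OF dY] this]
    have Y': "f2 w (X s) (Y s) = deriv (\<rho>2 M w) (u s) * u' s" .
    have mu: "mu M w (u s) = (f1 w (X s) (Y s))\<^sup>2 + (f2 w (X s) (Y s))\<^sup>2"
      by (simp add: mu_def \<rho>[OF s])
    show "lam M w (u s) * (u' s)\<^sup>2 = mu M w (u s)"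
      unfolding mu X' Y' by (simp add: lam_def power_mult_distrib algebra_simps)
    show "mu M w (u s) > 0"
      unfolding mu using flow_field_nonzero_on_level_curve[OF M level[of s]] by simp
  qed
  have nz: "u' s \<noteq> 0" if "s \<in> {a..b}" for s using speed[OF that] by auto
  define F where "F = (\<lambda>u. sqrt (lam M w u / mu M w u))"
  have F: "\<bar>u' s\<bar> * F (u s) = 1" if s: "s \<in> {a..b}" for s
  proof -
    have "\<bar>u' s\<bar> * F (u s) = sqrt ((u' s)\<^sup>2 * (lam M w (u s) / mu M w (u s)))"
      by (simp only: F_def real_sqrt_mult real_sqrt_abs)
    also have "(u' s)\<^sup>2 * (lam M w (u s) / mu M w (u s)) = 1"
      using speed[OF s] by (simp add: field_simps)
    finally show ?thesis by simp
  qed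
  have inj: "inj_on (\<lambda>s. (cos (u s), sin (u s))) {a..<b}"
  proof (rule inj_onI)
    fix s t assume st: "s \<in> {a..<b}" "t \<in> {a..<b}"
      and "(cos (u s), sin (u s)) = (cos (u t), sin (u t))"
    then have "X s = X t" "Y s = Y t"
      using \<rho>[of s] \<rho>[of t] by (simp_all add: \<rho>1_def \<rho>2_def)
    then have "treadmill_sled \<alpha> s = treadmill_sled \<alpha> t"
      using XY[of s] XY[of t] by simp
    then show "s = t" using bij st unfolding bij_betw_def inj_on_def by blast
  qed
  have "X b = X a" "Y b = Y a" using ends by (simp_all add: X_def Y_def)
  then have closed: "cos (u b) = cos (u a)" "sin (u b) = sin (u a)"
    using cos[of a] cos[of b] sin[of a] sin[of b] \<open>a < b\<close> by auto
  obtain c where inj_u: "inj_on u {a..b}" and image: "u ` {a..b} = {c..c + 2 * pi}"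
    using angle_full_turn[OF \<open>a < b\<close> du cont' nz inj closed] by blast
  have "((\<lambda>s. 1) has_integral (b - a)) {a..b}"
    using has_integral_const_real[of "1 :: real" a b] \<open>a < b\<close> by simp
  then have int: "((\<lambda>s. \<bar>u' s\<bar> * F (u s)) has_integral (b - a)) {a..b}"
    by (rule has_integral_eq[rotated]) (simp add: F)
  have "(\<lambda>s. \<bar>u' s\<bar> * F (u s)) absolutely_integrable_on {a..b}"
    by (rule nonnegative_absolutely_integrable_1) (use int F in auto)
  then have "(\<lambda>s. \<bar>u' s\<bar> * F (u s)) absolutely_integrable_on {a..b} \<and>
      integral {a..b} (\<lambda>s. \<bar>u' s\<bar> * F (u s)) = b - a"
    using int by (simp add: integral_unique)
  \<comment> \<open>The change of variables takes \<open>\<bar>u'\<bar>\<close>, so the sense of rotation does not matter.\<close>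
  then have "F absolutely_integrable_on {c..c + 2 * pi} \<and> integral {c..c + 2 * pi} F = b - a"
    using has_absolute_integral_change_of_variables_1'[of "{a..b}" u u' F "b - a"] du inj_u image
    by simp
  then have "(F has_integral (b - a)) {c..c + 2 * pi}"
    using set_lebesgue_integral_eq_integral(1) integrable_integral by metis
  then have "(F has_integral (b - a)) {0..2 * pi}"
    by (rule has_integral_periodic_interval[rotated 2]) (simp_all add: F_def length_density_periodic)
  moreover have "curve_length \<alpha> a b = b - a"
    using tw \<open>a < b\<close>
    by (simp add: curve_length_def twizzler_profile_def arc_length_parametrized_def)
  ultimately show ?thesis unfolding F_def by simp
qed

end
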